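(* Let $x^*\in K$ be a solution of the problem of maximizing $h(x)=u(a_1-f_1(x),\ldots,a_m-f_m(x))$ subject to $x\in K$. (i) If $u$ is weakly strictly monotone on its domain, then $x^*\in W$. (ii) If $u$ is strictly monotone on its domain, then $x^*\in P$. (iii) If $u$ is strictly monotone on the interior of its domain, and $x^*$ is a Slater point (i.e. $x^*\in K$ and $f_j(x^* )<a_j$ for all $j=1,\ldots,m$), then $x^*\in P$.
   Context: Setting: $K\subseteq\mathbb{R}^n$ is closed and convex; $f=(f_1,\ldots,f_m)^{\mathsf T}:\mathbb{R}^n\to\mathbb{R}^m$ with each $f_j$ convex; $a=(a_1,\ldots,a_m)^{\mathsf T}\in\mathbb{R}^m$; the set $\{x\in K: f_j(x)\le a_j,\ j=1,\ldots,m\}$ is nonempty and bounded. The multi-objective problem is to minimize $f(x)$ over $x\in K$. $P$ is the set of Pareto optimal points: $\widehat x\in K$ such that for every $x\in K$ either there is $j$ with $f_j(\widehat x)<f_j(x)$, or $f_j(\widehat x)\le f_j(x)$ for all $j$. $W$ is the set of weak Pareto optimal points: $\widehat x\in K$ such that for every $x\in K$ there is $j$ with $f_j(\widehat x)\le f_j(x)$. $u:\mathbb{R}^m\to\mathbb{R}\cup\{-\infty\}$ is a utility function with domain $\mathrm{dom}\,u=\{y:u(y)>-\infty\}=\mathbb{R}^m_+$ (vectors with nonnegative components), continuous on its domain. $\mathbb{R}^m_{++}$ denotes the vectors with positive components; it is the interior of $\mathrm{dom}\,u$. A point $x^*\in K$ is a solution if $h(x^* )\ge h(x)$ for all $x\in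 K$. Given a set $S$, $u$ is weakly strictly monotone on $S$ if $u(y+\delta)>u(y)$ for all $y\in S$, $\delta\in\mathbb{R}^m_{++}$ with $y+\delta\in S$; $u$ is strictly monotone on $S$ if $u(y+\delta)>u(y)$ for all $y\in S$, $\delta\in\mathbb{R}^m_+\setminus\{0\}$ with $y+\delta\in S$. *)

theory Defs
  imports "HOL-Analysis.Analysis"
begin

definition nonneg_orthant :: "(real ^ 'm) set" where
  "nonneg_orthant = {y. \<forall>j. 0 \<le> y $ j}"

definition pos_orthant :: "(real ^ 'm) set" where
  "pos_orthant = {y. \<forall>j. 0 < y $ j}"

definition pareto_optimal :: "(real ^ 'n) set \<Rightarrow> (real ^ 'n \<Rightarrow> real ^ 'm) \<Rightarrow> (real ^ 'n) set" where
  "pareto_optimal K f =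
     {z \<in> K. \<forall>x\<in>K. (\<exists>j. f z $ j < f x $ j) \<or> (\<forall>j. f z $ j \<le> f x $ j)}"

definition weak_pareto_optimal :: "(real ^ 'n) set \<Rightarrow> (real ^ 'n \<Rightarrow> real ^ 'm) \<Rightarrow> (real ^ 'n) set" where
  "weak_pareto_optimal K f = {z \<in> K. \<forall>x\<in>K. \<exists>j. f z $ j \<le> f x $ j}"

text \<open>Functions into the reals extended by minus infinity are modelled as functions into
  \<^typ>\<open>ereal\<close> that never take the value plus infinity; the latter is required by
  \<open>utility_function\<close> below.\<close>

definition eff_dom :: "(real ^ 'm \<Rightarrow> ereal) \<Rightarrow> (real ^ 'm) set" where
  "eff_dom u = {y. u y > -\<infinity>}"

definition utility_function :: "(real ^ 'm \<Rightarrow> ereal) \<Rightarrow> bool" where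
  "utility_function u \<longleftrightarrow>
     (\<forall>y. u y \<noteq> \<infinity>) \<and> eff_dom u = nonneg_orthant \<and> continuous_on (eff_dom u) u"

definition weakly_strictly_monotone_on ::
    "(real ^ 'm) set \<Rightarrow> (real ^ 'm \<Rightarrow> ereal) \<Rightarrow> bool" where
  "weakly_strictly_monotone_on S u \<longleftrightarrow>
     (\<forall>y\<in>S. \<forall>d\<in>pos_orthant. y + d \<in> S \<longrightarrow> u (y + d) > u y)"

definition strictly_monotone_on ::
    "(real ^ 'm) set \<Rightarrow> (real ^ 'm \<Rightarrow> ereal) \<Rightarrow> bool" where
  "strictly_monotone_on S u \<longleftrightarrow>
     (\<forall>y\<in>S. \<forall>d\<in>nonneg_orthant - {0}. y + d \<in> S \<longrightarrow> u (y + d) > u y)"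

definition utility_objective ::
    "(real ^ 'm \<Rightarrow> ereal) \<Rightarrow> real ^ 'm \<Rightarrow> (real ^ 'n \<Rightarrow> real ^ 'm) \<Rightarrow> real ^ 'n \<Rightarrow> ereal" where
  "utility_objective u a f x = u (\<chi> j. a $ j - f x $ j)"

definition maximizers :: "(real ^ 'n) set \<Rightarrow> (real ^ 'n \<Rightarrow> ereal) \<Rightarrow> (real ^ 'n) set" where
  "maximizers K h = {z \<in> K. \<forall>x\<in>K. h z \<ge> h x}"

definition slater_points ::
    "(real ^ 'n) set \<Rightarrow> (real ^ 'n \<Rightarrow> real ^ 'm) \<Rightarrow> real ^ 'm \<Rightarrow> (real ^ 'n) set" where
  "slater_points K f a = {x \<in> K. \<forall>j. f x $ j < a $ j}"

end

theory Submission imports Defs begin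

text \<open>The value of the objective at a point depends only on its slack vector \<open>a - f x\<close>. If a point
  \<open>x\<close> of \<open>K\<close> dominates a solution \<open>z\<close>, then the slack at \<open>x\<close> is the slack at \<open>z\<close> plus the vector
  \<open>f z - f x\<close>, which is positive when the domination is strict in every component, and nonnegative
  and nonzero when it is strict in at least one. Monotonicity of \<open>u\<close> then makes \<open>x\<close> strictly better
  than \<open>z\<close>, a contradiction, provided that both slack vectors lie in the set on which \<open>u\<close> is
  monotone.

  This proviso is settled at \<open>z\<close> and carries over to \<open>x\<close>, because the nonnegative and the positive
  orthant are both closed under addition of nonnegative vectors. The slack at a solution is
  nonnegative: some feasible point has utility above \<open>-\<infinity>\<close>, hence so has the solution
  (\<open>maximizer_slack_in_dom\<close>). At a Slater point it is moreover positive, and the positive orthant is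
  contained in the interior of the domain (\<open>pos_orthant_subset_interior\<close>). The two maximality
  arguments are \<open>maximizer_weak_pareto_optimal\<close> and \<open>maximizer_pareto_optimal\<close>; the latter, for an
  arbitrary set closed under nonnegative increments, serves both statements about Pareto
  optimality.\<close>

text \<open>Any feasible point has an objective value above \<open>-\<infinity>\<close>, whereas an infeasible point has the
  value \<open>-\<infinity>\<close> and so cannot be maximal.\<close>

lemma maximizer_slack_in_dom:
  fixes f :: "real ^ 'n \<Rightarrow> real ^ 'm"
  assumes dom: "eff_dom u = nonneg_orthant"
    and feasible: "{x \<in> K. \<forall>j. f x $ j \<le> a $ j} \<noteq> {}"
    and max: "z \<in> maximizers K (utility_objective u a f)"
  shows "a - f z \<in> eff_dom u"
proof -
  obtain x where "x \<in> K" and "\<forall>j. f x $ j \<le> a $ j"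
    using feasible by blast
  then have "a - f x \<in> eff_dom u"
    unfolding dom nonneg_orthant_def by simp
  moreover have "u (a - f x) \<le> u (a - f z)"
    using max \<open>x \<in> K\<close> by (simp add: maximizers_def utility_objective_def minus_vec_def)
  ultimately show ?thesis
    unfolding eff_dom_def by auto
qed

text \<open>Maximality of \<open>z\<close>, with the slack at \<open>x\<close> written as an increment of the slack at \<open>z\<close>, the form
  in which it contradicts the conclusion of a monotonicity property.\<close>

lemma no_better_slack:
  fixes f :: "real ^ 'n \<Rightarrow> real ^ 'm"
  assumes "z \<in> maximizers K (utility_objective u a f)" and "x \<in> K"
  shows "\<not> u (a - f z) < u ((a - f z) + (f z - f x))"
proof -
  have "(a - f z) + (f z - f x) = a - f x"
    by simp
  moreover have "u (a - f x) \<le> u (a - f z)"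
    using assms by (simp add: maximizers_def utility_objective_def minus_vec_def)
  ultimately show ?thesis
    by (simp only: not_less)
qed

lemma maximizer_weak_pareto_optimal:
  fixes f :: "real ^ 'n \<Rightarrow> real ^ 'm"
  assumes mono: "weakly_strictly_monotone_on S u"
    and up: "\<And>y d. y \<in> S \<Longrightarrow> d \<in> pos_orthant \<Longrightarrow> y + d \<in> S"
    and slack: "a - f z \<in> S"
    and max: "z \<in> maximizers K (utility_objective u a f)"
  shows "z \<in> weak_pareto_optimal K f"
proof -
  have "\<exists>j. f z $ j \<le> f x $ j" if "x \<in> K" for x
  proof (rule ccontr)
    assume "\<not> (\<exists>j. f z $ j \<le> f x $ j)"
    then have "f z - f x \<in> pos_orthant"
      by (auto simp: pos_orthant_def not_le)
    then have "u (a - f z) < u ((a - f z) + (f z - f x))"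
      using mono slack up unfolding weakly_strictly_monotone_on_def by blast
    then show False
      using no_better_slack[OF max that] by contradiction
  qed
  then show ?thesis
    using max by (simp add: weak_pareto_optimal_def maximizers_def)
qed

text \<open>The set \<open>S\<close> is left open because monotonicity on the closed orthant and on its interior lead to
  Pareto optimality by the same argument: \<open>S\<close> contains the slack at \<open>z\<close> and, being closed under
  nonnegative increments, the slack at any point dominating \<open>z\<close>.\<close>

lemma maximizer_pareto_optimal:
  fixes f :: "real ^ 'n \<Rightarrow> real ^ 'm"
  assumes mono: "strictly_monotone_on S u"
    and up: "\<And>y d. y \<in> S \<Longrightarrow> d \<in> nonneg_orthant \<Longrightarrow> y + d \<in> S"
    and slack: "a - f z \<in> S"
    and max: "z \<in> maximizers K (utility_objective u a f)"
  shows "z \<in> pareto_optimal K f"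
proof -
  have "(\<exists>j. f z $ j < f x $ j) \<or> (\<forall>j. f z $ j \<le> f x $ j)" if "x \<in> K" for x
  proof (rule ccontr)
    assume dominated: "\<not> ((\<exists>j. f z $ j < f x $ j) \<or> (\<forall>j. f z $ j \<le> f x $ j))"
    then have "f z - f x \<in> nonneg_orthant"
      by (auto simp: nonneg_orthant_def not_less)
    moreover have "f z - f x \<noteq> 0"
      using dominated by auto
    ultimately have "u (a - f z) < u ((a - f z) + (f z - f x))"
      using mono slack up unfolding strictly_monotone_on_def by blast
    then show False
      using no_better_slack[OF max that] by contradiction
  qed
  then show ?thesis
    using max by (simp add: pareto_optimal_def maximizers_def)
qed

lemma nonneg_orthant_add:
  "y \<in> nonneg_orthant \<Longrightarrow> d \<in> nonneg_orthant \<Longrightarrow> y + d \<in> nonneg_orthant"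
  by (simp add: nonneg_orthant_def)

lemma pos_orthant_add_nonneg:
  "y \<in> pos_orthant \<Longrightarrow> d \<in> nonneg_orthant \<Longrightarrow> y + d \<in> pos_orthant"
  by (simp add: nonneg_orthant_def pos_orthant_def add_pos_nonneg)

lemma pos_orthant_subset_nonneg: "pos_orthant \<subseteq> nonneg_orthant"
  by (auto simp: nonneg_orthant_def pos_orthant_def intro: less_imp_le)

lemma pos_orthant_subset_interior:
  "pos_orthant \<subseteq> interior (nonneg_orthant :: (real ^ 'm) set)"
proof (rule interior_maximal[OF pos_orthant_subset_nonneg])
  show "open (pos_orthant :: (real ^ 'm) set)"
    unfolding pos_orthant_def Collect_all_eq
    by (intro open_INT open_Collect_less continuous_intros ballI finite)
qed

theorem theorem2p10:
  fixes K :: "(real ^ 'n) set"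
    and f :: "real ^ 'n \<Rightarrow> real ^ 'm"
    and a :: "real ^ 'm"
    and u :: "real ^ 'm \<Rightarrow> ereal"
    and xs :: "real ^ 'n"
  assumes "closed K" and "convex K"
    and "\<And>j. convex_on UNIV (\<lambda>x. f x $ j)"
    and "{x \<in> K. \<forall>j. f x $ j \<le> a $ j} \<noteq> {}"
    and "bounded {x \<in> K. \<forall>j. f x $ j \<le> a $ j}"
    and "utility_function u"
    and "xs \<in> maximizers K (utility_objective u a f)"
  shows "(weakly_strictly_monotone_on (eff_dom u) u \<longrightarrow> xs \<in> weak_pareto_optimal K f) \<and>
    (strictly_monotone_on (eff_dom u) u \<longrightarrow> xs \<in> pareto_optimal K f) \<and>
    (strictly_monotone_on (interior (eff_dom u)) u \<and> xs \<in> slater_points K f a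
       \<longrightarrow> xs \<in> pareto_optimal K f)"
proof (intro conjI impI)
  have dom: "eff_dom u = nonneg_orthant"
    using assms(6) by (simp add: utility_function_def)
  have slack: "a - f xs \<in> eff_dom u"
    using maximizer_slack_in_dom[OF dom assms(4,7)] .
  show "xs \<in> weak_pareto_optimal K f" if "weakly_strictly_monotone_on (eff_dom u) u"
    using maximizer_weak_pareto_optimal[OF that _ slack assms(7)]
      nonneg_orthant_add pos_orthant_subset_nonneg dom by blast
  show "xs \<in> pareto_optimal K f" if "strictly_monotone_on (eff_dom u) u"
    using maximizer_pareto_optimal[OF that _ slack assms(7)] nonneg_orthant_add dom by blast
  show "xs \<in> pareto_optimal K f"
    if slater: "strictly_monotone_on (interior (eff_dom u)) u \<and> xs \<in> slater_points K f a"
  proof (rule maximizer_pareto_optimal[OF _ pos_orthant_add_nonneg _ assms(7)])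
    show "strictly_monotone_on pos_orthant u"
      using slater pos_orthant_subset_interior unfolding dom strictly_monotone_on_def by blast
    show "a - f xs \<in> pos_orthant"
      using slater by (simp add: slater_points_def pos_orthant_def)
  qed
qed

end
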